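(* There is an absolute constant $c_0>0$ (independent of $r$, $\Gamma$ and $\phi$) such that for every $r>0$ there exists $\delta=\delta(r)>0$ with the following property. Let $\Gamma=\Gamma_{x,y}$ be a lattice of density $1$ with basis $v'=v_1(x,y)$, $w'=w_1(x,y)$ such that $d(\Lambda,\Gamma)<\delta$, where $\Lambda$ is the hexagonal lattice of density $1$, and let $p$ be its deep hole (fixed, not moved with the lattice). Then $$\sum_{\mu\in C_r}\|p-\mu\|-\sum_{\lambda\in A_r}\|p-\lambda\|\;\ge\; c_0\, r\,|A_r|\,d(\Lambda,\Gamma)^2 .$$ Moreover, if $\phi:\mathbb{R}_+\to\mathbb{R}$ is any monotonically increasing, convex function (differentiable at $r$, so that $\phi'(r)$ is defined), then $$\sum_{\mu\in C_r}\phi(\|p-\mu\|)-\sum_{\lambda\in A_r}\phi(\|p-\lambda\|)\;\ge\; c_0\, r\,\phi'(r)\,|A_r|\,d(\Lambda,\Gamma)^2 .$$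
   Context: $\|\cdot\|$ is the Euclidean norm on $\mathbb{R}^2$. Lattices of density $1$ (fundamental cell of area $1$) are considered up to rotation and parametrized by $(x,y)\in\mathbb{R}\times(0,\infty)$: $\Gamma_{x,y}=\{k v_1+l w_1: k,l\in\mathbb{Z}\}$ with $$v_1(x,y)=y^{-1/2}(1,0),\qquad w_1(x,y)=y^{-1/2}(x,y).$$ The hexagonal lattice $\Lambda$ corresponds to $(x,y)=(1/2,\sqrt{3}/2)$, with basis vectors $$v=\frac{\sqrt2}{3^{1/4}}(1,0),\qquad w=\frac{1}{3^{1/4}\sqrt2}(1,\sqrt3).$$ The deep hole (circumcenter of the fundamental triangle) is $p=\tfrac13(v+w)$. For $r>0$ set $A_r=\{\lambda\in\Lambda:\|\lambda-p\|=r\}$ (a finite, possibly empty set), $B_r=\{(k,l)\in\mathbb{Z}^2:\|kv+lw-p\|=r\}$, and, for a lattice $\Gamma=\Gamma_{x,y}$ with basis $v'=v_1(x,y)=y^{-1/2}(1,0)$, $w'=w_1(x,y)=y^{-1/2}(x,y)$, $C_r=\{kv'+lw':(k,l)\in B_r\}\subset\Gamma$. Here $|A_r|$ is the cardinality of $A_r$. The distance $d(\Lambda,\Gamma)$ is the Euclidean distance in $\mathbb{R}^4$ between the concatenated basis vectors $(v,w)$ and $(v',w')$. *)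

theory Defs
  imports "HOL-Analysis.Analysis"
begin

definition basis_v :: "real \<Rightarrow> real \<Rightarrow> real^2" where
  "basis_v x y = (y powr (-1/2)) *\<^sub>R vector [1, 0]"

definition basis_w :: "real \<Rightarrow> real \<Rightarrow> real^2" where
  "basis_w x y = (y powr (-1/2)) *\<^sub>R vector [x, y]"

definition lattice_point :: "real \<Rightarrow> real \<Rightarrow> int \<times> int \<Rightarrow> real^2" where
  "lattice_point x y = (\<lambda>(k, l). of_int k *\<^sub>R basis_v x y + of_int l *\<^sub>R basis_w x y)"

definition lattice2 :: "real \<Rightarrow> real \<Rightarrow> (real^2) set" where
  "lattice2 x y = range (lattice_point x y)"

abbreviation hex_x :: real where "hex_x \<equiv> 1 / 2"
abbreviation hex_y :: real where "hex_y \<equiv> sqrt 3 / 2"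

definition hex_v :: "real^2" where "hex_v = basis_v hex_x hex_y"
definition hex_w :: "real^2" where "hex_w = basis_w hex_x hex_y"
definition hex_lattice :: "(real^2) set" where "hex_lattice = lattice2 hex_x hex_y"

lemma hex_y_powr: "hex_y powr (-1/2) = sqrt 2 / 3 powr (1/4)"
proof -
  have "hex_y powr (-1/2) = 1 / sqrt hex_y"
    using powr_minus[of hex_y "1/2"] powr_half_sqrt[of hex_y] by (simp add: inverse_eq_divide)
  also have "sqrt hex_y = sqrt (sqrt 3) / sqrt 2"
    by (simp add: real_sqrt_divide)
  also have "sqrt (sqrt 3) = (3::real) powr (1/4)"
  proof -
    have "sqrt (sqrt 3) = (3 powr (1/2)) powr (1/2)"
      by (simp add: powr_half_sqrt)
    also have "\<dots> = (3::real) powr (1/4)"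
      by (simp only: powr_powr) simp
    finally show ?thesis .
  qed
  finally show ?thesis by simp
qed

lemma hex_v_coordinates: "hex_v = (sqrt 2 / 3 powr (1/4)) *\<^sub>R vector [1, 0]"
  by (simp only: hex_v_def basis_v_def hex_y_powr)

lemma hex_w_coordinates: "hex_w = (1 / (3 powr (1/4) * sqrt 2)) *\<^sub>R vector [1, sqrt 3]"
proof -
  have "sqrt 2 / 3 powr (1/4) = 2 * (1 / (3 powr (1/4) * sqrt 2))"
    by (simp add: field_simps)
  then show ?thesis
    unfolding hex_w_def basis_w_def hex_y_powr by (simp add: vec_eq_iff forall_2)
qed

definition deep_hole :: "real^2" where
  "deep_hole = (1 / 3) *\<^sub>R (hex_v + hex_w)"

definition A_shell :: "real \<Rightarrow> (real^2) set" where
  "A_shell r = {z \<in> hex_lattice. norm (z - deep_hole) = r}"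

definition B_shell :: "real \<Rightarrow> (int \<times> int) set" where
  "B_shell r =
    {(k, l). norm (of_int k *\<^sub>R hex_v + of_int l *\<^sub>R hex_w - deep_hole) = r}"

definition C_shell :: "real \<Rightarrow> real \<Rightarrow> real \<Rightarrow> (real^2) set" where
  "C_shell x y r = lattice_point x y ` B_shell r"

(* The product metric on real^2 \<times> real^2 is the Euclidean metric of the
   concatenated coordinates in R^4. The value depends on the chosen bases,
   not only on the two lattices as sets. *)
definition dist_from_hex :: "real \<Rightarrow> real \<Rightarrow> real" where
  "dist_from_hex x y = dist (hex_v, hex_w) (basis_v x y, basis_w x y)"

end

theory Submission
  imports Defs
begin

text \<open>
  Write \<open>q\<close> for the vector from the deep hole \<open>p\<close> to a lattice point and \<open>q'\<close> for its counterpart in the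
  deformed lattice. For a fixed similarity \<open>M\<close> of ratio \<open>s\<close>, Cauchy--Schwarz gives
  \<open>s r \<parallel>q'\<parallel> \<ge> q' \<bullet> M q\<close>. The shell is invariant under the rotation by \<open>2\<pi>/3\<close> about \<open>p\<close>, which
  acts on coefficients by \<open>(k, l) \<mapsto> (1 - k - l, k)\<close>, so the right-hand side sums to an
  explicit bilinear expression in the two bases, and the translation caused by keeping \<open>p\<close> fixed drops out.
  Optimising \<open>M\<close> yields, with \<open>h = \<surd>3/2\<close>,
  \<open>\<Sum> \<parallel>q'\<parallel> \<ge> r |A| \<surd>(1 + ((h - y)\<^sup>2 + (x - 1/2)\<^sup>2) / (4 h y))\<close>, and the fraction dominates
  \<open>d\<^sup>2/8\<close>. The version for \<open>\<phi>\<close> follows from the tangent line inequality at \<open>r\<close>; smallness of \<open>\<delta>\<close> in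
  terms of \<open>r\<close> is only used to keep the points of the deformed shell away from \<open>p\<close>.
\<close>

section \<open>Coordinates and distances to the deep hole\<close>

lemma norm_real2: "(norm (z :: real^2))\<^sup>2 = (z $ 1)\<^sup>2 + (z $ 2)\<^sup>2"
  unfolding power2_norm_eq_inner by (simp add: inner_vec_def sum_2 power2_eq_square)

lemma inner_real2: "(z :: real^2) \<bullet> w = z $ 1 * w $ 1 + z $ 2 * w $ 2"
  by (simp add: inner_vec_def sum_2)

text \<open>The norm form of the Eisenstein integers, centred at the coefficients (1/3, 1/3) of the
  deep hole.\<close>

definition eisenstein_form :: "int \<times> int \<Rightarrow> real" where
  "eisenstein_form = (\<lambda>(k, l). (of_int k - 1/3)\<^sup>2 + (of_int k - 1/3) * (of_int l - 1/3) + (of_int l - 1/3)\<^sup>2)"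

text \<open>In the centred coefficients K = k - 1/3, L = l - 1/3 this is the linear map (K, L) ->
  (-K - L, K).\<close>

definition hex_rot :: "int \<times> int \<Rightarrow> int \<times> int" where
  "hex_rot = (\<lambda>(k, l). (1 - k - l, k))"

lemma powr_minus_half: "y > 0 \<Longrightarrow> y powr - (1/2) = 1 / sqrt y" for y :: real
  by (simp add: powr_minus powr_half_sqrt inverse_eq_divide)

lemma basis_v_nth: "y > 0 \<Longrightarrow> basis_v x y $ 1 = 1 / sqrt y" "basis_v x y $ 2 = 0"
  by (simp_all add: basis_v_def powr_minus_half)

lemma basis_w_nth: "y > 0 \<Longrightarrow> basis_w x y $ 1 = x / sqrt y" "y > 0 \<Longrightarrow> basis_w x y $ 2 = sqrt y"
  by (simp_all add: basis_w_def powr_minus_half real_div_sqrt)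

lemma hex_v_nth: "hex_v $ 1 = 1 / sqrt hex_y" "hex_v $ 2 = 0"
  unfolding hex_v_def by (rule basis_v_nth; simp)+

lemma hex_w_nth: "hex_w $ 1 = (1 / 2) / sqrt hex_y" "hex_w $ 2 = sqrt hex_y"
  unfolding hex_w_def by (rule basis_w_nth; simp)+

lemma hex_y_pos: "hex_y > 0"
  by simp

lemma hex_offset:
  "lattice_point hex_x hex_y (k, l) - deep_hole = (of_int k - 1/3) *\<^sub>R hex_v + (of_int l - 1/3) *\<^sub>R hex_w"
  by (simp add: lattice_point_def deep_hole_def hex_v_def hex_w_def algebra_simps)

lemma norm_hex_combination: "(norm (K *\<^sub>R hex_v + L *\<^sub>R hex_w))\<^sup>2 = (K\<^sup>2 + K * L + L\<^sup>2) / hex_y"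
proof -
  define \<alpha> where "\<alpha> = 1 / sqrt hex_y"
  have "sqrt c = c * (1 / sqrt c)" if "c > 0" for c :: real
    using that by (simp add: real_div_sqrt)
  from this[OF hex_y_pos] have \<alpha>: "\<alpha>\<^sup>2 = 1 / hex_y" "sqrt hex_y = hex_y * \<alpha>"
    unfolding \<alpha>_def by (simp_all only: power_divide power_one real_sqrt_pow2 hex_y_pos less_imp_le)
  have "(norm (K *\<^sub>R hex_v + L *\<^sub>R hex_w))\<^sup>2 = (K * \<alpha> + L * (1/2 * \<alpha>))\<^sup>2 + (L * (hex_y * \<alpha>))\<^sup>2"
    by (simp only: norm_real2 vector_add_component vector_scaleR_component hex_v_nth hex_w_nth
        flip: \<alpha>(2)) (simp add: \<alpha>_def)
  also have "\<dots> = (K\<^sup>2 + K * L + L\<^sup>2 * (1/4 + hex_y\<^sup>2)) * \<alpha>\<^sup>2"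
    by (simp add: power2_eq_square algebra_simps)
  also have "\<dots> = (K\<^sup>2 + K * L + L\<^sup>2) / hex_y"
    by (simp add: \<alpha> power_divide)
  finally show ?thesis .
qed

lemma norm_hex_offset: "(norm (lattice_point hex_x hex_y kl - deep_hole))\<^sup>2 = eisenstein_form kl / hex_y"
  by (cases kl) (simp only: hex_offset norm_hex_combination eisenstein_form_def prod.case)

section \<open>Shells as finite index sets\<close>

lemma mem_B_shell_iff_norm:
  "kl \<in> B_shell r \<longleftrightarrow> norm (lattice_point hex_x hex_y kl - deep_hole) = r"
  by (cases kl) (simp add: B_shell_def lattice_point_def hex_v_def hex_w_def)

lemma mem_B_shell_iff: "r \<ge> 0 \<Longrightarrow> kl \<in> B_shell r \<longleftrightarrow> eisenstein_form kl = hex_y * r\<^sup>2"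
proof -
  assume "r \<ge> 0"
  then have "kl \<in> B_shell r \<longleftrightarrow> (norm (lattice_point hex_x hex_y kl - deep_hole))\<^sup>2 = r\<^sup>2"
    unfolding mem_B_shell_iff_norm by simp
  then show ?thesis
    unfolding norm_hex_offset by (simp add: field_simps)
qed

text \<open>Completing the square in two ways, the form dominates 3/4 of the square of either
  centred coefficient.\<close>

lemma finite_B_shell: "finite (B_shell r)"
proof (rule finite_subset)
  let ?m = "\<lceil>2 * r\<^sup>2 + 3\<rceil>"
  have bound: "\<bar>k\<bar> \<le> ?m" if "(of_int k - 1/3)\<^sup>2 \<le> 2 * r\<^sup>2" for k :: int
  proof -
    \<comment> \<open>The inequality |t| <= 1 + t^2 yields a bound on k without square
      roots.\<close>
    have "\<bar>of_int k - 1/3 :: real\<bar> \<le> 1 + (of_int k - 1/3)\<^sup>2"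
      using zero_le_power2[of "\<bar>of_int k - 1/3 :: real\<bar> - 1"]
        zero_le_power2[of "of_int k - 1/3 :: real"]
      by (simp add: power2_diff)
    then have "\<bar>of_int k :: real\<bar> \<le> 2 * r\<^sup>2 + 3"
      using that by linarith
    then show ?thesis
      by linarith
  qed
  show "B_shell r \<subseteq> {- ?m..?m} \<times> {- ?m..?m}"
  proof (clarify)
    fix k l assume kl: "(k, l) \<in> B_shell r"
    define K L :: real where "K = of_int k - 1/3" and "L = of_int l - 1/3"
    have "K\<^sup>2 + K * L + L\<^sup>2 = hex_y * r\<^sup>2"
      using kl norm_hex_offset[of "(k, l)"]
      by (simp add: mem_B_shell_iff_norm eisenstein_form_def K_def L_def field_simps)
    moreover have "hex_y * r\<^sup>2 \<le> 1 * r\<^sup>2"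
      by (intro mult_right_mono) (auto intro: real_le_lsqrt)
    moreover have "K\<^sup>2 + K * L + L\<^sup>2 = 3/4 * K\<^sup>2 + (K/2 + L)\<^sup>2"
      "K\<^sup>2 + K * L + L\<^sup>2 = 3/4 * L\<^sup>2 + (L/2 + K)\<^sup>2"
      by (simp_all add: power2_eq_square field_simps)
    ultimately have "3/4 * K\<^sup>2 \<le> r\<^sup>2" "3/4 * L\<^sup>2 \<le> r\<^sup>2"
      using zero_le_power2[of "K/2 + L"] zero_le_power2[of "L/2 + K"] by linarith+
    then have "K\<^sup>2 \<le> 2 * r\<^sup>2" "L\<^sup>2 \<le> 2 * r\<^sup>2"
      using zero_le_power2[of r] by linarith+
    then show "k \<in> {- ?m..?m} \<and> l \<in> {- ?m..?m}"
      using bound[of k] bound[of l] unfolding K_def L_def by auto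
  qed
qed simp

lemma inj_lattice_point: "y > 0 \<Longrightarrow> inj (lattice_point x y)"
proof (rule injI)
  fix a b assume y: "y > 0" and eq: "lattice_point x y a = lattice_point x y b"
  obtain k l k' l' where ab: "a = (k, l)" "b = (k', l')"
    by fastforce
  have "lattice_point x y a $ 1 = lattice_point x y b $ 1"
    "lattice_point x y a $ 2 = lattice_point x y b $ 2"
    using eq by simp_all
  then have "of_int l * sqrt y = of_int l' * sqrt y"
    "of_int k / sqrt y + of_int l * (x / sqrt y) = of_int k' / sqrt y + of_int l' * (x / sqrt y)"
    using y by (simp_all add: ab lattice_point_def basis_v_nth basis_w_nth)
  then show "a = b"
    using y by (auto simp: ab)
qed

lemma A_shell_eq: "A_shell r = lattice_point hex_x hex_y ` B_shell r"
  by (auto simp: A_shell_def hex_lattice_def lattice2_def mem_B_shell_iff_norm)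

lemma card_A_shell: "card (A_shell r) = card (B_shell r)"
  unfolding A_shell_eq by (intro card_image inj_on_subset[OF inj_lattice_point]) auto

lemma sum_A_shell: "(\<Sum>z\<in>A_shell r. f (norm (deep_hole - z))) = real (card (A_shell r)) * f r"
  by (simp add: A_shell_def norm_minus_commute)

text \<open>\<open>C_shell\<close> is a set, so injectivity is what keeps distinct indices from
  being merged in the sum.\<close>

lemma sum_C_shell:
  "y > 0 \<Longrightarrow> (\<Sum>\<mu>\<in>C_shell x y r. f \<mu>) = (\<Sum>kl\<in>B_shell r. f (lattice_point x y kl))"
  unfolding C_shell_def
  by (subst sum.reindex[OF inj_on_subset[OF inj_lattice_point]]) auto

section \<open>Threefold symmetry of the shell\<close>

lemma hex_rot_cubed: "hex_rot (hex_rot (hex_rot kl)) = kl"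
  by (cases kl) (simp add: hex_rot_def)

lemma eisenstein_form_hex_rot: "eisenstein_form (hex_rot kl) = eisenstein_form kl"
  by (cases kl) (simp add: hex_rot_def eisenstein_form_def power2_eq_square algebra_simps)

lemma sum_B_shell_hex_rot:
  assumes "r \<ge> 0"
  shows "(\<Sum>kl\<in>B_shell r. f (hex_rot kl)) = (\<Sum>kl\<in>B_shell r. f kl)"
  by (rule sum.reindex_bij_witness[of _ "\<lambda>kl. hex_rot (hex_rot kl)" hex_rot])
    (simp_all add: hex_rot_cubed mem_B_shell_iff[OF assms] eisenstein_form_hex_rot)

text \<open>Along an orbit of \<open>hex_rot\<close> the first coefficient runs through K, -K - L,
  L, and the second through the same values. Both sum to zero, so \<open>s\<close> cancels. The sums
  of K^2, L^2 and K L are 2, 2 and -1 times the form, which equals \<open>hex_y * r\<^sup>2\<close>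
  on the shell.\<close>

lemma sum_B_shell_bilinear:
  fixes v w a b s :: "'a :: real_inner"
  assumes "r \<ge> 0"
  shows "(\<Sum>(k, l)\<in>B_shell r.
      ((of_int k - 1/3) *\<^sub>R v + (of_int l - 1/3) *\<^sub>R w + s) \<bullet>
      ((of_int k - 1/3) *\<^sub>R a + (of_int l - 1/3) *\<^sub>R b)) =
    real (card (B_shell r)) * (hex_y * r\<^sup>2 / 3) * (2 * (v \<bullet> a) + 2 * (w \<bullet> b) - v \<bullet> b - w \<bullet> a)"
proof -
  define F where "F = (\<lambda>(k :: int, l :: int).
      ((of_int k - 1/3) *\<^sub>R v + (of_int l - 1/3) *\<^sub>R w + s) \<bullet>
      ((of_int k - 1/3) *\<^sub>R a + (of_int l - 1/3) *\<^sub>R b))"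
  have orbit: "F kl + F (hex_rot kl) + F (hex_rot (hex_rot kl)) =
      eisenstein_form kl * (2 * (v \<bullet> a) + 2 * (w \<bullet> b) - v \<bullet> b - w \<bullet> a)" for kl
  proof (cases kl)
    case (Pair k l)
    define K L :: real where "K = of_int k - 1/3" and "L = of_int l - 1/3"
    have kl: "real_of_int k = K + 1/3" "real_of_int l = L + 1/3"
      by (simp_all add: K_def L_def)
    show ?thesis
      unfolding Pair F_def hex_rot_def eisenstein_form_def prod.case of_int_diff of_int_1 kl
      by (simp add: inner_add_left inner_add_right inner_diff_left power2_eq_square field_simps)
  qed
  \<comment> \<open>Counting every index three times avoids choosing orbit representatives and
    explains the divisor 3.\<close>
  have "3 * (\<Sum>kl\<in>B_shell r. F kl) =
      (\<Sum>kl\<in>B_shell r. F kl + F (hex_rot kl) + F (hex_rot (hex_rot kl)))"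
    using sum_B_shell_hex_rot[OF assms, of F] sum_B_shell_hex_rot[OF assms, of "\<lambda>kl. F (hex_rot kl)"]
    by (simp add: sum.distrib)
  also have "\<dots> = real (card (B_shell r)) * (hex_y * r\<^sup>2 * (2 * (v \<bullet> a) + 2 * (w \<bullet> b) - v \<bullet> b - w \<bullet> a))"
    unfolding orbit sum_constant[symmetric]
    by (intro sum.cong) (simp_all only: mem_B_shell_iff[OF assms])
  finally show ?thesis
    unfolding F_def by (simp add: field_simps)
qed

section \<open>Lower bound for the sum of distances\<close>

text \<open>
  This is \<open>4 sinh\<^sup>2(\<rho>/2)\<close> for the hyperbolic distance \<open>\<rho>\<close> between \<open>(x, y)\<close> and the hexagonal point.
\<close>

definition hex_deviation :: "real \<Rightarrow> real \<Rightarrow> real" where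
  "hex_deviation x y = ((hex_y - y)\<^sup>2 + (x - 1/2)\<^sup>2) / (hex_y * y)"

lemma sum_norm_ge_sqrt_deviation:
  assumes "y > 0" "r > 0"
  shows "(\<Sum>kl\<in>B_shell r. norm (lattice_point x y kl - deep_hole)) \<ge>
    real (card (B_shell r)) * r * sqrt (1 + hex_deviation x y / 4)"
proof -
  define h where "h = hex_y"
  have h: "h > 0" "h\<^sup>2 = 3/4"
    by (simp_all add: h_def power_divide)
  \<comment> \<open>\<open>M\<close> will be multiplication by the complex number C + i D, of ratio
    |(C, D)|. For arbitrary C and D the bilinear expression is 2 h ((h + y) C + (1/2 - x) D) / sqrt
    (h y), so relative to the ratio it is largest when (C, D) is parallel to (h + y, 1/2 -
    x).\<close>
  define C D where "C = h + y" and "D = 1/2 - x"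
  define S where "S = sqrt (C\<^sup>2 + D\<^sup>2)"
  have "C > 0"
    using h assms by (simp add: C_def)
  then have S: "S > 0" "S\<^sup>2 = C\<^sup>2 + D\<^sup>2"
    by (simp_all add: S_def sum_power2_gt_zero_iff)
  define M :: "real^2 \<Rightarrow> real^2"
    where "M = (\<lambda>z. vector [C * z $ 1 - D * z $ 2, D * z $ 1 + C * z $ 2])"
  have M_lin: "M (K *\<^sub>R z + L *\<^sub>R z') = K *\<^sub>R M z + L *\<^sub>R M z'" for K L z z'
    by (simp add: M_def vec_eq_iff forall_2 algebra_simps)
  have M_norm: "norm (M z) = S * norm z" for z
  proof (rule power2_eq_imp_eq)
    show "(norm (M z))\<^sup>2 = (S * norm z)\<^sup>2"
      by (simp add: norm_real2 M_def power_mult_distrib S) (simp add: power2_eq_square algebra_simps)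
  qed (use S in auto)
  \<comment> \<open>The linear map between the two bases moves the deep hole by \<open>s\<close>,
    whereas distances are measured from the unmoved one.\<close>
  define s where "s = (1/3) *\<^sub>R (basis_v x y + basis_w x y) - deep_hole"
  have offset: "lattice_point x y (k, l) - deep_hole =
      (of_int k - 1/3) *\<^sub>R basis_v x y + (of_int l - 1/3) *\<^sub>R basis_w x y + s" for k l
    by (simp add: lattice_point_def s_def algebra_simps)
  have bilinear: "2 * (basis_v x y \<bullet> M hex_v) + 2 * (basis_w x y \<bullet> M hex_w) - basis_v x y \<bullet> M hex_w
      - basis_w x y \<bullet> M hex_v = 2 * h * S\<^sup>2 / sqrt (h * y)"
  proof -
    have *: "sqrt y = y * (1 / sqrt y)" "sqrt h = h * (1 / sqrt h)"
      using h assms by (simp_all add: real_div_sqrt)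
    define p q where "p = 1 / sqrt y" and "q = 1 / sqrt h"
    have v: "basis_v x y $ 1 = p" "basis_v x y $ 2 = 0" "basis_w x y $ 1 = x * p"
        "basis_w x y $ 2 = y * p" "hex_v $ 1 = q" "hex_v $ 2 = 0" "hex_w $ 1 = q / 2" "hex_w $ 2 = h * q"
      using assms * hex_v_nth hex_w_nth unfolding p_def q_def
      by (simp_all add: basis_v_nth basis_w_nth h_def)
    have "2 * (basis_v x y \<bullet> M hex_v) + 2 * (basis_w x y \<bullet> M hex_w) - basis_v x y \<bullet> M hex_w
      - basis_w x y \<bullet> M hex_v = (3/2 * C + 2 * h * y * C + h * D * (1 - 2 * x)) * (p * q)"
      by (simp add: inner_real2 M_def v) (simp add: algebra_simps)
    also have "3/2 * C + 2 * h * y * C + h * D * (1 - 2 * x) = 2 * h * S\<^sup>2"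
    proof -
      have "3/2 * C = 2 * h\<^sup>2 * C"
        by (simp add: h)
      then show ?thesis
        unfolding S by (simp add: C_def D_def power2_eq_square algebra_simps)
    qed
    finally show ?thesis
      by (simp add: p_def q_def real_sqrt_mult)
  qed
  have "(\<Sum>kl\<in>B_shell r. (lattice_point x y kl - deep_hole) \<bullet> M (lattice_point hex_x hex_y kl - deep_hole)) =
      (\<Sum>(k, l)\<in>B_shell r.
        ((of_int k - 1/3) *\<^sub>R basis_v x y + (of_int l - 1/3) *\<^sub>R basis_w x y + s) \<bullet>
        ((of_int k - 1/3) *\<^sub>R M hex_v + (of_int l - 1/3) *\<^sub>R M hex_w))"
    by (rule sum.cong) (auto simp only: offset hex_offset M_lin prod.case)
  then have "real (card (B_shell r)) * (h * r\<^sup>2 / 3) * (2 * h * S\<^sup>2 / sqrt (h * y)) =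
      (\<Sum>kl\<in>B_shell r. (lattice_point x y kl - deep_hole) \<bullet> M (lattice_point hex_x hex_y kl - deep_hole))"
    using sum_B_shell_bilinear[of r "basis_v x y" "basis_w x y" s "M hex_v" "M hex_w"] assms
    unfolding bilinear by (simp add: h_def)
  also have "\<dots> \<le> (\<Sum>kl\<in>B_shell r. norm (lattice_point x y kl - deep_hole) * (S * r))"
  proof (rule sum_mono)
    fix kl assume "kl \<in> B_shell r"
    then show "(lattice_point x y kl - deep_hole) \<bullet> M (lattice_point hex_x hex_y kl - deep_hole)
        \<le> norm (lattice_point x y kl - deep_hole) * (S * r)"
      using norm_cauchy_schwarz[of "lattice_point x y kl - deep_hole" "M (lattice_point hex_x hex_y kl - deep_hole)"]
      by (simp add: M_norm mem_B_shell_iff_norm)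
  qed
  finally have "real (card (B_shell r)) * (h * r\<^sup>2 / 3) * (2 * h * S\<^sup>2 / sqrt (h * y)) \<le>
      (\<Sum>kl\<in>B_shell r. norm (lattice_point x y kl - deep_hole)) * (S * r)"
    by (simp add: sum_distrib_right)
  moreover have "real (card (B_shell r)) * (h * r\<^sup>2 / 3) * (2 * h * S\<^sup>2 / sqrt (h * y)) =
      real (card (B_shell r)) * r * (S / (2 * sqrt (h * y))) * (S * r)"
  proof -
    have "real (card (B_shell r)) * (h * r\<^sup>2 / 3) * (2 * h * S\<^sup>2 / sqrt (h * y)) =
        real (card (B_shell r)) * r * (S / (2 * sqrt (h * y))) * (S * r) * (4 * h\<^sup>2 / 3)"
      by (simp add: power2_eq_square ac_simps)
    then show ?thesis
      unfolding h(2) by simp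
  qed
  moreover have "S / (2 * sqrt (h * y)) = sqrt (1 + hex_deviation x y / 4)"
  proof -
    \<comment> \<open>This rests on (h - y)^2 + 4 h y = (h + y)^2.\<close>
    have "1 + hex_deviation x y / 4 = S\<^sup>2 / (4 * (h * y))"
      using h assms unfolding S hex_deviation_def h_def[symmetric]
      by (simp add: C_def D_def power2_eq_square field_simps)
    moreover have "S / (2 * sqrt (h * y)) = sqrt (S\<^sup>2 / (4 * (h * y)))"
      using S(1) by (simp add: real_sqrt_divide real_sqrt_mult)
    ultimately show ?thesis
      by simp
  qed
  ultimately have "real (card (B_shell r)) * r * sqrt (1 + hex_deviation x y / 4) * (S * r) \<le>
      (\<Sum>kl\<in>B_shell r. norm (lattice_point x y kl - deep_hole)) * (S * r)"
    by (simp only:)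
  then show ?thesis
    by (rule mult_right_le_imp_le) (use S assms in simp)
qed

text \<open>All coordinate differences are expressed through \<open>Y - H\<close> and
  \<open>e\<close>; then (Y - H) (Y + H) = y - h returns from square roots to \<open>y\<close> and
  \<open>h\<close>.\<close>

lemma dist_from_hex_le_deviation:
  assumes "y > 0"
  shows "(dist_from_hex x y)\<^sup>2 \<le> 2 * hex_deviation x y"
proof -
  define h where "h = hex_y"
  have h: "h > 0" "3/4 \<le> h" "h \<le> 1"
    using real_le_rsqrt[of "3/2" 3] real_le_lsqrt[of 2 3] by (auto simp: h_def power2_eq_square)
  define Y H where "Y = sqrt y" and "H = sqrt h"
  have YH: "Y > 0" "H > 0" "Y\<^sup>2 = y" "H\<^sup>2 = h"
    using h assms by (simp_all add: Y_def H_def)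
  define e where "e = x - 1/2"
  define g where "g = 1 / Y - 1 / H"
  have v: "basis_v x y $ 1 = 1 / Y" "basis_v x y $ 2 = 0" "basis_w x y $ 1 = x / Y"
      "basis_w x y $ 2 = Y" "hex_v $ 1 = 1 / H" "hex_v $ 2 = 0" "hex_w $ 1 = (1/2) / H" "hex_w $ 2 = H"
    using assms hex_v_nth hex_w_nth unfolding Y_def H_def h_def
    by (simp_all add: basis_v_nth basis_w_nth)
  have "(dist_from_hex x y)\<^sup>2 = g\<^sup>2 + (x / Y - (1/2) / H)\<^sup>2 + (Y - H)\<^sup>2"
    unfolding dist_from_hex_def dist_Pair_Pair
    by (simp add: dist_norm norm_real2 v g_def power2_commute)
  also have "x / Y - (1/2) / H = e / Y + g / 2"
    by (simp add: e_def g_def diff_divide_distrib)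
  \<comment> \<open>(a + b)^2 <= 2 a^2 + 2 b^2 separates the shear \<open>e\<close> from the
    rescaling \<open>g\<close>.\<close>
  also have "(e / Y + g / 2)\<^sup>2 \<le> 2 * (e / Y)\<^sup>2 + g\<^sup>2 / 2"
    using zero_le_power2[of "e / Y - g / 2"] by (simp add: power2_sum power2_diff power_divide)
  also have "g\<^sup>2 = (Y - H)\<^sup>2 / (h * y)"
    using YH by (simp add: g_def flip: YH(3,4)) (simp add: field_simps power2_eq_square)
  also have "(Y - H)\<^sup>2 / (h * y) + (2 * (e / Y)\<^sup>2 + (Y - H)\<^sup>2 / (h * y) / 2) + (Y - H)\<^sup>2 =
      ((3/2 + h * y) * (Y - H)\<^sup>2 + 2 * h * e\<^sup>2) / (h * y)"
    using YH h assms by (simp add: power_divide field_simps)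
  also have "\<dots> \<le> (2 * (h + y) * (Y - H)\<^sup>2 + 2 * e\<^sup>2) / (h * y)"
  proof -
    \<comment> \<open>Termwise: 3/2 <= 2 h since h >= 3/4, and h y <= 2 y since h <= 1.\<close>
    have "3/2 + h * y \<le> 2 * (h + y)"
      unfolding distrib_left by (rule add_mono) (use h assms in auto)
    moreover have "2 * h * e\<^sup>2 \<le> 2 * e\<^sup>2"
      using h by (simp add: mult_left_le_one_le)
    ultimately show ?thesis
      using h assms by (intro divide_right_mono add_mono mult_right_mono) auto
  qed
  also have "\<dots> \<le> (2 * ((h - y)\<^sup>2 + e\<^sup>2)) / (h * y)"
  proof -
    \<comment> \<open>Here h + y = H^2 + Y^2 <= (Y + H)^2.\<close>
    have "(h + y) * (Y - H)\<^sup>2 \<le> (Y + H)\<^sup>2 * (Y - H)\<^sup>2"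
      using YH by (intro mult_right_mono) (auto simp: power2_sum)
    also have "\<dots> = (h - y)\<^sup>2"
      unfolding YH(3,4)[symmetric] by (simp add: power2_eq_square algebra_simps)
    finally have "2 * (h + y) * (Y - H)\<^sup>2 \<le> 2 * (h - y)\<^sup>2"
      unfolding mult.assoc by (rule mult_left_mono) simp
    then show ?thesis
      unfolding distrib_left[of 2 "(h - y)\<^sup>2"] using h assms
      by (intro divide_right_mono add_right_mono) simp_all
  qed
  also have "\<dots> = 2 * hex_deviation x y"
    by (simp add: hex_deviation_def h_def e_def)
  finally show ?thesis
    by simp
qed

text \<open>Combines the two preceding bounds by linearising the square root; this fixes the
  absolute constant.\<close>

lemma sum_norm_gap:
  assumes "y > 0" "r > 0" "dist_from_hex x y \<le> 1"
  shows "(\<Sum>kl\<in>B_shell r. norm (lattice_point x y kl - deep_hole)) - real (card (B_shell r)) * r \<ge>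
    1/24 * r * real (card (B_shell r)) * (dist_from_hex x y)\<^sup>2"
proof -
  define d where "d = dist_from_hex x y"
  have "0 \<le> d" "d \<le> 1"
    using assms by (simp_all add: d_def dist_from_hex_def)
  then have d: "0 \<le> d\<^sup>2" "d\<^sup>2 \<le> 1"
    by (simp_all add: power_le_one)
  \<comment> \<open>The root is at least sqrt (1 + d^2/8). As d^4 <= d^2 and 1/12 + 1/576 < 1/8, the
    slope 1/24 stays below it.\<close>
  have "(1 + d\<^sup>2 / 24)\<^sup>2 = 1 + d\<^sup>2 / 12 + d\<^sup>2 * d\<^sup>2 / 576"
    by (simp add: power2_eq_square algebra_simps)
  then have "(1 + d\<^sup>2 / 24)\<^sup>2 \<le> 1 + d\<^sup>2 / 8"
    using mult_left_le[OF d(2,1)] d by linarith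
  also have "\<dots> \<le> 1 + hex_deviation x y / 4"
    using dist_from_hex_le_deviation[OF assms(1), of x] by (simp add: d_def)
  finally have "1 + d\<^sup>2 / 24 \<le> sqrt (1 + hex_deviation x y / 4)"
    by (rule real_le_rsqrt)
  then have "real (card (B_shell r)) * r * (1 + d\<^sup>2 / 24) \<le>
      real (card (B_shell r)) * r * sqrt (1 + hex_deviation x y / 4)"
    using assms by (intro mult_left_mono) auto
  with sum_norm_ge_sqrt_deviation[OF assms(1,2), of x] show ?thesis
    by (simp add: d_def algebra_simps)
qed

section \<open>Keeping the deformed shell away from the deep hole\<close>

lemma lattice_point_perturbation:
  "norm (lattice_point hex_x hex_y (k, l) - lattice_point x y (k, l)) \<le>
    of_int (\<bar>k\<bar> + \<bar>l\<bar>) * dist_from_hex x y"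
proof -
  have "lattice_point hex_x hex_y (k, l) - lattice_point x y (k, l) =
      of_int k *\<^sub>R (hex_v - basis_v x y) + of_int l *\<^sub>R (hex_w - basis_w x y)"
    by (simp add: lattice_point_def hex_v_def hex_w_def algebra_simps)
  then have "norm (lattice_point hex_x hex_y (k, l) - lattice_point x y (k, l)) \<le>
      \<bar>of_int k\<bar> * dist hex_v (basis_v x y) + \<bar>of_int l\<bar> * dist hex_w (basis_w x y)"
    by (metis dist_norm norm_scaleR norm_triangle_ineq)
  also have "\<dots> \<le> \<bar>of_int k\<bar> * dist_from_hex x y + \<bar>of_int l\<bar> * dist_from_hex x y"
    using dist_fst_le[of "(hex_v, hex_w)" "(basis_v x y, basis_w x y)"]
      dist_snd_le[of "(hex_v, hex_w)" "(basis_v x y, basis_w x y)"]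
    unfolding dist_from_hex_def by (intro add_mono mult_left_mono) auto
  finally show ?thesis
    by (simp add: algebra_simps)
qed

text \<open>Convexity of \<phi> is given on the positive reals only, so its tangent inequality needs
  every distance to be positive. An undeformed point has distance r, and it suffices that it moves
  by less than r.\<close>

lemma ex_delta_avoiding_deep_hole:
  assumes "r > 0"
  obtains \<delta> where "\<delta> > 0"
    "\<And>x y kl. dist_from_hex x y < \<delta> \<Longrightarrow> kl \<in> B_shell r \<Longrightarrow> lattice_point x y kl \<noteq> deep_hole"
proof -
  \<comment> \<open>Summing over the finite shell bounds the coefficients of all its points at once,
    so one \<delta> serves them all.\<close>
  define m where "m = (\<Sum>(k, l)\<in>B_shell r. real_of_int (\<bar>k\<bar> + \<bar>l\<bar>))"
  have m: "m \<ge> 0"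
    unfolding m_def by (intro sum_nonneg) auto
  show thesis
  proof
    \<comment> \<open>The added 1 keeps the denominator positive when \<open>m\<close> is 0, as for
      an empty shell.\<close>
    show "r / (m + 1) > 0"
      using m assms by simp
    fix x y :: real and kl
    assume d: "dist_from_hex x y < r / (m + 1)" and kl: "kl \<in> B_shell r"
    obtain k l where [simp]: "kl = (k, l)"
      by fastforce
    have "real_of_int (\<bar>k\<bar> + \<bar>l\<bar>) \<le> m"
      using member_le_sum[OF kl, of "\<lambda>(k, l). real_of_int (\<bar>k\<bar> + \<bar>l\<bar>)"]
      by (auto simp: m_def finite_B_shell)
    then have "norm (lattice_point hex_x hex_y kl - lattice_point x y kl) \<le> (m + 1) * dist_from_hex x y"
      using lattice_point_perturbation[of k l x y]
        mult_right_mono[of "of_int (\<bar>k\<bar> + \<bar>l\<bar>)" "m + 1" "dist_from_hex x y"]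
      by (simp add: dist_from_hex_def)
    also have "\<dots> < r"
      using d m by (simp add: field_simps)
    finally show "lattice_point x y kl \<noteq> deep_hole"
      using kl by (auto simp: mem_B_shell_iff_norm)
  qed
qed

section \<open>The sum of distances and its monotone convex versions\<close>

theorem theorem1:
  "\<exists>c0::real. c0 > 0 \<and>
    (\<forall>r::real. r > 0 \<longrightarrow>
      (\<exists>\<delta>::real. \<delta> > 0 \<and>
        (\<forall>x y :: real. y > 0 \<and> dist_from_hex x y < \<delta> \<longrightarrow>
          (\<Sum>\<mu>\<in>C_shell x y r. norm (deep_hole - \<mu>)) - (\<Sum>z\<in>A_shell r. norm (deep_hole - z))
            \<ge> c0 * r * real (card (A_shell r)) * (dist_from_hex x y)\<^sup>2
          \<and>
          (\<forall>(\<phi> :: real \<Rightarrow> real) \<phi>'.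
            mono_on {0<..} \<phi> \<and> convex_on {0<..} \<phi> \<and> (\<phi> has_real_derivative \<phi>') (at r) \<longrightarrow>
            (\<Sum>\<mu>\<in>C_shell x y r. \<phi> (norm (deep_hole - \<mu>))) - (\<Sum>z\<in>A_shell r. \<phi> (norm (deep_hole - z)))
              \<ge> c0 * r * \<phi>' * real (card (A_shell r)) * (dist_from_hex x y)\<^sup>2))))"
proof (rule exI[of _ "1/24"], intro conjI allI impI)
  fix r :: real assume r: "r > 0"
  from ex_delta_avoiding_deep_hole[OF r] obtain \<delta> where \<delta>: "\<delta> > 0"
    "\<And>x y kl. dist_from_hex x y < \<delta> \<Longrightarrow> kl \<in> B_shell r \<Longrightarrow> lattice_point x y kl \<noteq> deep_hole"
    by blast
  show "\<exists>\<delta>>0. \<forall>x y :: real. y > 0 \<and> dist_from_hex x y < \<delta> \<longrightarrow>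
      (\<Sum>\<mu>\<in>C_shell x y r. norm (deep_hole - \<mu>)) - (\<Sum>z\<in>A_shell r. norm (deep_hole - z))
        \<ge> 1/24 * r * real (card (A_shell r)) * (dist_from_hex x y)\<^sup>2
      \<and>
      (\<forall>(\<phi> :: real \<Rightarrow> real) \<phi>'.
        mono_on {0<..} \<phi> \<and> convex_on {0<..} \<phi> \<and> (\<phi> has_real_derivative \<phi>') (at r) \<longrightarrow>
        (\<Sum>\<mu>\<in>C_shell x y r. \<phi> (norm (deep_hole - \<mu>))) - (\<Sum>z\<in>A_shell r. \<phi> (norm (deep_hole - z)))
          \<ge> 1/24 * r * \<phi>' * real (card (A_shell r)) * (dist_from_hex x y)\<^sup>2)"
  \<comment> \<open>The bound 1 serves \<open>sum_norm_gap\<close>; \<delta> ensures positive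
    distances for the inequality with \<phi>.\<close>
  proof (intro exI[of _ "min 1 \<delta>"] conjI allI impI; (elim conjE)?)
    show "min 1 \<delta> > 0"
      using \<delta>(1) by simp
  next
    fix x y :: real assume y: "y > 0" and d: "dist_from_hex x y < min 1 \<delta>"
    show "(\<Sum>\<mu>\<in>C_shell x y r. norm (deep_hole - \<mu>)) - (\<Sum>z\<in>A_shell r. norm (deep_hole - z))
        \<ge> 1/24 * r * real (card (A_shell r)) * (dist_from_hex x y)\<^sup>2"
      using sum_norm_gap[OF y r, of x] d sum_A_shell[of "\<lambda>t. t"]
      unfolding sum_C_shell[OF y] card_A_shell norm_minus_commute[of deep_hole] by simp
  next
    fix x y :: real and \<phi> :: "real \<Rightarrow> real" and \<phi>'
    assume y: "y > 0" and d: "dist_from_hex x y < min 1 \<delta>"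
      and mono: "mono_on {0<..} \<phi>" and conv: "convex_on {0<..} \<phi>"
      and deriv: "(\<phi> has_real_derivative \<phi>') (at r)"
    let ?f = "\<lambda>kl. norm (lattice_point x y kl - deep_hole)"
    \<comment> \<open>Monotonicity enters here: the gap may then be multiplied by the slope.\<close>
    have "\<phi>' \<ge> 0"
      using mono_on_imp_deriv_nonneg[OF mono deriv] r by (simp add: interior_open)
    then have "\<phi>' * (1/24 * r * real (card (B_shell r)) * (dist_from_hex x y)\<^sup>2) \<le>
        \<phi>' * ((\<Sum>kl\<in>B_shell r. ?f kl) - real (card (B_shell r)) * r)"
      using sum_norm_gap[OF y r, of x] d by (intro mult_left_mono) auto
    also have "\<dots> = (\<Sum>kl\<in>B_shell r. \<phi>' * (?f kl - r))"
      by (simp add: sum_subtractf flip: sum_distrib_left)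
    \<comment> \<open>Convexity puts \<phi> above its tangent at \<open>r\<close>, term by
      term.\<close>
    also have "\<dots> \<le> (\<Sum>kl\<in>B_shell r. \<phi> (?f kl) - \<phi> r)"
    proof (rule sum_mono)
      fix kl assume "kl \<in> B_shell r"
      then have "?f kl > 0"
        using \<delta>(2)[of x y kl] d by simp
      then show "\<phi>' * (?f kl - r) \<le> \<phi> (?f kl) - \<phi> r"
        using r by (intro convex_on_imp_above_tangent[OF conv])
          (auto simp: interior_open intro: has_field_derivative_at_within[OF deriv])
    qed
    finally show "(\<Sum>\<mu>\<in>C_shell x y r. \<phi> (norm (deep_hole - \<mu>))) - (\<Sum>z\<in>A_shell r. \<phi> (norm (deep_hole - z)))
        \<ge> 1/24 * r * \<phi>' * real (card (A_shell r)) * (dist_from_hex x y)\<^sup>2"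
      unfolding sum_C_shell[OF y] sum_A_shell card_A_shell unfolding norm_minus_commute[of deep_hole]
      by (simp add: sum_subtractf ac_simps)
  qed
qed simp

end
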